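(* For every $\epsilon>0$, every $r,m\in\mathbb{N}$ with $m\ge3$, and every irredundant, positive and abundant matrix $A\in\mathcal{M}_{r\times m}(\mathbb{Z})$ there exists a constant $c=c(A,\epsilon)>0$ such that \[ \lim_{n\to\infty}\mathbb{P}\big([n]_p\to^{\star}_{\epsilon}A\big)=0\quad\text{if } p(n)\le c\,n^{-1/m_1(A)}. \]
   Context: $[n]=\{1,\dots,n\}$; $[n]_p$ is the binomial random subset of $[n]$ containing each element independently with probability $p=p(n)$. For $A\in\mathcal{M}_{r\times m}(\mathbb{Z})$ let $\mathcal{S}(A)=\{\mathbf{x}\in\mathbb{Z}^m:A\mathbf{x}^T=\mathbf{0}\}$ and $\mathcal{S}_0(A)=\{\mathbf{x}\in\mathcal{S}(A):x_i\ne x_j\text{ for }i\ne j\}$. $A$ is irredundant if $\mathcal{S}_0(A)\ne\emptyset$, positive if $\mathcal{S}(A)\cap\mathbb{N}^m\ne\emptyset$, abundant if deleting any two columns leaves a matrix with the same rank as $A$. For $\mathbf{x}\in\mathcal{S}(A)$, $\mathcal{P}[\mathbf{x}]=\{\{j:x_j=x_i\}:1\le i\le m\}$. For a set partition $\mathcal{P}=\{T_1,\dots,T_k\}$ of $[m]$ with $\min T_1<\dots<\min T_k$, $A_{\mathcal{P}}$ is the matrix whose $j$-th column is $\sum_{i\in T_j}\mathbf{c}_i$ ($\mathbf{c}_i$ the $i$-th column of $A$). $\mathcal{S}_1(A)=\{\mathbf{x}\in\mathcal{S}(A):\mathrm{rank}(A_{\mathcal{P}[\mathbf{x}]})=\mathrm{rank}(A)\}$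 (non-trivial solutions). For a set $T$ of integers, $T\to^\star_\epsilon A$ means every $S\subseteq T$ with $|S|/|T|\ge\epsilon$ satisfies $S^m\cap\mathcal{S}_1(A)\ne\emptyset$. For $Q\subseteq[m]$, $A^{\bar Q}$ is the submatrix of columns indexed by $[m]\setminus Q$ (empty matrix has rank $0$), $r_Q=\mathrm{rank}(A)-\mathrm{rank}(A^{\bar Q})$, and $m_1(A)=\max_{Q\subseteq[m],|Q|\ge2}\frac{|Q|-1}{|Q|-r_Q-1}$.
   Formalization: Proved for 0 < ε < 1 and nonzero A only, since the claim fails for ε ≥ 1 (only S = T or no S is tested) and for the zero matrix (m_1 = 1, p = c/n); for T empty, where |S|/|T| is undefined, S = ∅ counts as dense, so the relation fails. *)

theory Defs
  imports
    "HOL-Probability.Probability"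
    "Jordan_Normal_Form.DL_Rank"
    "Jordan_Normal_Form.DL_Submatrix"
    "Jordan_Normal_Form.Matrix_Kernel"
begin

(* Rows, columns and coordinates are numbered from 0, as in Jordan_Normal_Form, so the
   column index set [m] is {..<dim_col A}.  The ambient set [n] of the random model keeps
   its actual elements {1..n}. *)

definition int_rank :: "int mat \<Rightarrow> nat" where
  "int_rank A = vec_space.rank (dim_row A) (map_mat rat_of_int A)"

(* S(A) is the library's mat_kernel A. *)

definition proper_solutions :: "int mat \<Rightarrow> int vec set" where
  "proper_solutions A =
     {x \<in> mat_kernel A. \<forall>i<dim_col A. \<forall>j<dim_col A. i \<noteq> j \<longrightarrow> x $ i \<noteq> x $ j}"

definition irredundant :: "int mat \<Rightarrow> bool" where
  "irredundant A \<longleftrightarrow> proper_solutions A \<noteq> {}"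

(* The natural numbers start at 1 here: with 0 allowed, the zero solution would make every
   matrix positive. *)
definition positive_mat :: "int mat \<Rightarrow> bool" where
  "positive_mat A \<longleftrightarrow> (\<exists>x \<in> mat_kernel A. \<forall>i<dim_col A. x $ i > 0)"

definition delete_cols :: "int mat \<Rightarrow> nat set \<Rightarrow> int mat" where
  "delete_cols A Q = submatrix A UNIV ({..<dim_col A} - Q)"

definition abundant :: "int mat \<Rightarrow> bool" where
  "abundant A \<longleftrightarrow>
     (\<forall>i<dim_col A. \<forall>j<dim_col A. i \<noteq> j \<longrightarrow> int_rank (delete_cols A {i, j}) = int_rank A)"

definition vec_partition :: "int vec \<Rightarrow> nat set set" where
  "vec_partition x = (\<lambda>i. {j. j < dim_vec x \<and> x $ j = x $ i}) ` {..<dim_vec x}"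

(* The blocks T_1, ..., T_k of a set partition, listed by increasing minimum (from index 0). *)
definition block :: "nat set set \<Rightarrow> nat \<Rightarrow> nat set" where
  "block P j = (THE T. T \<in> P \<and> Min T = sorted_list_of_set (Min ` P) ! j)"

definition contract_mat :: "int mat \<Rightarrow> nat set set \<Rightarrow> int mat" where
  "contract_mat A P = mat (dim_row A) (card P) (\<lambda>(i, j). \<Sum>k\<in>block P j. A $$ (i, k))"

definition nontrivial_solutions :: "int mat \<Rightarrow> int vec set" where
  "nontrivial_solutions A =
     {x \<in> mat_kernel A. int_rank (contract_mat A (vec_partition x)) = int_rank A}"

(* The relation T ->*_eps A, for finite T.  The density condition |S|/|T| >= eps is cleared
   of its denominator, so that for T = {} the subset S = {} does qualify (and then violates
   the relation); reading 0/0 as 0 would make the relation hold vacuously for T = {}. *)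
definition dense_solvable :: "real \<Rightarrow> int set \<Rightarrow> int mat \<Rightarrow> bool" where
  "dense_solvable \<epsilon> T A \<longleftrightarrow>
     (\<forall>S\<subseteq>T. real (card S) \<ge> \<epsilon> * real (card T) \<longrightarrow>
        (\<exists>x \<in> nontrivial_solutions A. \<forall>i<dim_col A. x $ i \<in> S))"

definition rank_drop :: "int mat \<Rightarrow> nat set \<Rightarrow> int" where
  "rank_drop A Q = int (int_rank A) - int (int_rank (delete_cols A Q))"

definition max_1_density :: "int mat \<Rightarrow> real" where
  "max_1_density A =
     Max ((\<lambda>Q. (real (card Q) - 1) / (real (card Q) - real_of_int (rank_drop A Q) - 1))
            ` {Q. Q \<subseteq> {..<dim_col A} \<and> card Q \<ge> 2})"

definition random_subset :: "nat \<Rightarrow> real \<Rightarrow> int set pmf" where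
  "random_subset n p =
     map_pmf (\<lambda>f. {k \<in> {1..int n}. f k}) (Pi_pmf {1..int n} False (\<lambda>_. bernoulli_pmf p))"

end

(*
  Let Q attain the maximum in m_1(A), put q = |Q| and rho = r_Q, so that 1 - 1/m_1(A) = rho/(q-1)
  with rho >= 1.  Fix a pattern P of repeated coordinates of a non-trivial solution.  As
  rank(A_P) = rank(A), the block sums span all columns of A, so at least rho of the blocks meeting Q
  are independent modulo the columns outside Q, and the values of a solution on these blocks are
  determined by its values on the other blocks meeting Q.  Hence the sets x(Q) with q' elements
  that come from solutions in [n]^m of a fixed pattern number at most n^(q' - rho), and the expected
  number mu of sets x(Q) inside [n]_p is O(max(1,np)^q / n^rho); this is at most O(c) np if np >= 1.
  If np is bounded, mu tends to 0.  If np is large, delete from [n]_p a maximal disjoint family of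
  sets x(Q): the probability that there are k disjoint ones is at most exp(e mu - k), so fewer
  than (1 - eps)|[n]_p| elements are lost, except with probability exponentially small in np.
*)

theory Submission
  imports Defs
begin

section \<open>Generating families of columns\<close>

no_notation vec_nth (infixl "$" 90)

context vec_space
begin

lemma indpt_card_le_span:
  assumes "finite B" "B \<subseteq> carrier_vec n" "finite U" "lin_indpt U" "U \<subseteq> span B"
  shows "card U \<le> card B"
proof -
  \<comment> \<open>The exchange lemma bounds a cardinality by a difference of integers, so the mere
    existence of \<open>C\<close> makes that difference nonnegative.\<close>
  have "\<exists>C :: 'a Matrix.vec set. int (card C) \<le> int (card B) - int (card U)"
    using replacement[of U B] assms by blast
  then show ?thesis by linarith
qed

text \<open>Take a maximal independent set of columns: any further column would make it dependent,
  hence lies in its span, and the size of such a set is the rank. Working with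
  \<open>set (cols A)\<close> makes order and repetition of columns irrelevant.\<close>

lemma spanning_subset_of_cols:
  assumes A: "A \<in> carrier_mat n nc"
  obtains B where "B \<subseteq> set (cols A)" "finite B" "lin_indpt B" "card B = rank A"
    "set (cols A) \<subseteq> span B"
proof -
  let ?P = "\<lambda>T. T \<subseteq> set (cols A) \<and> lin_indpt T"
  have cA: "set (cols A) \<subseteq> carrier_vec n" using A cols_dim by blast
  have "?P {}" by (auto simp: lin_dep_def)
  then obtain B where fB: "finite B" and mB: "maximal B ?P"
    using maximal_exists_superset[of "set (cols A)" ?P "{}"] by blast
  have B: "B \<subseteq> set (cols A)" "lin_indpt B" using mB by (auto simp: maximal_def)
  have cB: "B \<subseteq> carrier_vec n" using B cA by blast
  have "a \<in> span B" if a: "a \<in> set (cols A)" for a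
  proof (cases "a \<in> B")
    case True
    then show ?thesis using span_mem[of B a] cB by auto
  next
    case False
    have "\<not> lin_indpt (B \<union> {a})"
      using mB a B(1) False unfolding maximal_def by blast
    then show ?thesis using lin_dep_iff_in_span[of B a] cB B a cA False by auto
  qed
  then show thesis using that[of B] B fB rank_card_indpt[OF A mB] by auto
qed

lemma rank_le_card_generating:
  assumes A: "A \<in> carrier_mat n nc" and "finite B" "B \<subseteq> carrier_vec n" "set (cols A) \<subseteq> span B"
  shows "rank A \<le> card B"
proof -
  obtain U where "U \<subseteq> set (cols A)" "finite U" "lin_indpt U" "card U = rank A"
    using spanning_subset_of_cols[OF A] by metis
  then show ?thesis using indpt_card_le_span[of B U] assms by auto
qed

text \<open>A column of \<open>A\<close> outside the span of a maximal independent set of columns of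
  \<open>C\<close> would enlarge that set to \<open>rank A + 1\<close> independent vectors, all
  inside the span of \<open>rank A\<close> columns of \<open>A\<close>.\<close>

lemma cols_subset_span_if_rank_eq:
  assumes A: "A \<in> carrier_mat n nc" and C: "C \<in> carrier_mat n nd"
    and sub: "set (cols C) \<subseteq> span (set (cols A))" and rk: "rank C = rank A"
  shows "set (cols A) \<subseteq> span (set (cols C))"
proof
  fix a assume a: "a \<in> set (cols A)"
  have cA: "set (cols A) \<subseteq> carrier_vec n" and cC: "set (cols C) \<subseteq> carrier_vec n"
    using A C cols_dim by blast+
  obtain B where B: "B \<subseteq> set (cols C)" "finite B" "lin_indpt B" "card B = rank C"
    using spanning_subset_of_cols[OF C] by metis
  obtain B' where B': "B' \<subseteq> set (cols A)" "finite B'" "card B' = rank A"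
     "set (cols A) \<subseteq> span B'" using spanning_subset_of_cols[OF A] by metis
  have cB': "B' \<subseteq> carrier_vec n" using B' cA by auto
  have cB: "B \<subseteq> carrier_vec n" using B cC by auto
  have "span (set (cols A)) \<subseteq> span B'"
    using B'(4) cB' by (rule span_subsetI[rotated])
  then have sp: "insert a B \<subseteq> span B'" using sub B(1) B'(4) a by auto
  have "a \<in> span B"
  proof (rule ccontr)
    assume na: "a \<notin> span B"
    have naB: "a \<notin> B" using na span_mem[of B a] cB by auto
    have "lin_indpt (B \<union> {a})" using lin_dep_iff_in_span[of B a] na naB cB B a cA by auto
    then have "card (insert a B) \<le> card B'"
      using indpt_card_le_span[of B' "insert a B"] B' cB' B(2) sp by auto
    then show False using naB B B' rk by simp
  qed
  then show "a \<in> span (set (cols C))" using span_is_monotone[OF B(1)] by auto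
qed

lemma weighted_sum_in_span:
  assumes S: "S \<subseteq> carrier_vec n" and "finite F" and "\<And>T. T \<in> F \<Longrightarrow> v T \<in> span S"
  shows "vec n (\<lambda>i. \<Sum>T\<in>F. c T * v T $ i) \<in> span S"
  using assms(2,3)
proof (induction F)
  case empty
  have "vec n (\<lambda>i. \<Sum>T\<in>{}. c T * v T $ i) = 0\<^sub>v n" by auto
  then show ?case using span_is_monotone[of "{}" S] span_empty by auto
next
  case (insert T F)
  have cT: "v T \<in> carrier_vec n" using insert.prems[of T] S by (simp add: span_closed)
  have "vec n (\<lambda>i. \<Sum>T\<in>insert T F. c T * v T $ i) =
     c T \<cdot>\<^sub>v v T + vec n (\<lambda>i. \<Sum>T\<in>F. c T * v T $ i)"
    using insert.hyps cT by (intro eq_vecI) auto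
  moreover have "c T \<cdot>\<^sub>v v T \<in> span S" by (intro smult_in_span S insert.prems) auto
  ultimately show ?case using span_add1[OF S] insert by simp
qed

text \<open>Minimality of \<open>R\<close> replaces linear independence modulo \<open>W\<close>; as the family \<open>v\<close> is indexed,
  repeated vectors cause no trouble.\<close>

lemma minimal_generating_family:
  assumes W: "W \<subseteq> carrier_vec n" and P: "finite P" and v: "\<And>T. T \<in> P \<Longrightarrow> v T \<in> carrier_vec n"
    and O: "\<And>T. T \<in> P - I \<Longrightarrow> v T \<in> span W" and IP: "I \<subseteq> P"
  obtains R where "R \<subseteq> I" "v ` P \<subseteq> span (W \<union> v ` R)"
    "\<And>z T. (\<And>i. i < n \<Longrightarrow> (\<Sum>T\<in>P. z T * v T $ i) = 0) \<Longrightarrow> (\<And>T. T \<in> I - R \<Longrightarrow> z T = 0)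
        \<Longrightarrow> T \<in> R \<Longrightarrow> z T = 0"
proof -
  let ?G = "\<lambda>R. R \<subseteq> I \<and> v ` P \<subseteq> span (W \<union> v ` R)"
  have car: "W \<union> v ` R \<subseteq> carrier_vec n" if "R \<subseteq> P" for R using W v that by auto
  have "?G I"
  proof (intro conjI subset_refl, clarify)
    fix T assume "T \<in> P"
    show "v T \<in> span (W \<union> v ` I)"
    proof (cases "T \<in> I")
      case True
      then show ?thesis using span_mem[of "W \<union> v ` I" "v T"] car[OF IP] by auto
    next
      case False
      then have "v T \<in> span W" using O \<open>T \<in> P\<close> by auto
      then show ?thesis using span_is_monotone[of W "W \<union> v ` I"] by auto
    qed
  qed
  then obtain R where R: "?G R" and min: "\<And>S. ?G S \<Longrightarrow> card R \<le> card S"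
    using ex_has_least_nat[of ?G I card] by blast
  have RP: "R \<subseteq> P" using R IP by auto
  have fR: "finite R" using RP P finite_subset by blast
  have "z T0 = 0" if eq: "\<And>i. i < n \<Longrightarrow> (\<Sum>T\<in>P. z T * v T $ i) = 0"
    and z0: "\<And>T. T \<in> I - R \<Longrightarrow> z T = 0" and T0: "T0 \<in> R" for z T0
  proof (rule ccontr)
    assume nz: "z T0 \<noteq> 0"
    let ?S = "W \<union> v ` (R - {T0})"
    have cS: "?S \<subseteq> carrier_vec n" using car[of "R - {T0}"] RP by auto
    \<comment> \<open>The indices other than \<open>T0\<close> whose coefficient may be nonzero.
      Each is in \<open>R\<close> or outside \<open>I\<close>, so solving the relation for
      \<open>v T0\<close> puts \<open>v T0\<close> in the span of \<open>?S\<close>, and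
      \<open>R\<close> without \<open>T0\<close> would still generate.\<close>
    let ?F = "P - {T0} - (I - R)"
    have mem: "v T \<in> span ?S" if "T \<in> ?F" for T
    proof (cases "T \<in> R")
      case True
      then show ?thesis using span_mem[of ?S "v T"] cS that by auto
    next
      case False
      then have "v T \<in> span W" using O that by auto
      then show ?thesis using span_is_monotone[of W ?S] by auto
    qed
    have "v T0 = vec n (\<lambda>i. \<Sum>T\<in>?F. (- z T / z T0) * v T $ i)"
    proof (rule eq_vecI)
      fix i assume "i < dim_vec (vec n (\<lambda>i. \<Sum>T\<in>?F. (- z T / z T0) * v T $ i))"
      then have i: "i < n" by simp
      have "(\<Sum>T\<in>P. z T * v T $ i) = z T0 * v T0 $ i + (\<Sum>T\<in>P-{T0}. z T * v T $ i)"
        using P T0 RP by (intro sum.remove) auto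
      also have "(\<Sum>T\<in>P-{T0}. z T * v T $ i) = (\<Sum>T\<in>?F. z T * v T $ i)"
        using P z0 by (intro sum.mono_neutral_right) auto
      finally have "v T0 $ i = - (\<Sum>T\<in>?F. z T * v T $ i) / z T0"
        using eq[OF i] nz by (simp add: field_simps eq_neg_iff_add_eq_0)
      also have "\<dots> = (\<Sum>T\<in>?F. (- z T / z T0) * v T $ i)"
        by (simp add: sum_negf sum_divide_distrib)
      finally show "v T0 $ i = vec n (\<lambda>i. \<Sum>T\<in>?F. (- z T / z T0) * v T $ i) $ i" using i by simp
    qed (use v T0 RP in auto)
    also have "\<dots> \<in> span ?S"
      by (rule weighted_sum_in_span[OF cS]) (use P mem in auto)
    finally have T0S: "v T0 \<in> span ?S" .
    have "W \<union> v ` R \<subseteq> span ?S"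
      using T0S in_own_span[of ?S] cS by auto
    then have "span (W \<union> v ` R) \<subseteq> span ?S" by (rule span_subsetI[OF cS])
    then have "?G (R - {T0})" using R by auto
    from min[OF this] show False using card_Diff1_less[OF fR T0] by simp
  qed
  then show thesis using that[of R] R by blast
qed

end

section \<open>Patterns of repeated coordinates\<close>

text \<open>\<open>submatrix\<close> renumbers the surviving columns through \<open>pick\<close>;
  the set of columns does not see the renumbering, because \<open>pick\<close> maps the new
  positions onto the old indices.\<close>

lemma set_cols_delete_cols:
  "set (cols (map_mat f (delete_cols A Q))) = col (map_mat f A) ` ({..<dim_col A} - Q)"
proof -
  let ?J = "{..<dim_col A} - Q" and ?A = "map_mat f (delete_cols A Q)"
  let ?N = "card {j. j < dim_col A \<and> j \<in> ?J}"
  have NJ: "{j. j < dim_col A \<and> j \<in> ?J} = ?J" by auto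
  have N: "dim_col ?A = ?N" by (simp add: delete_cols_def dim_submatrix)
  have pickJ: "pick ?J j \<in> ?J" if "j < ?N" for j
    using that unfolding NJ by (rule pick_in_set_le)
  have col: "col ?A j = col (map_mat f A) (pick ?J j)" if j: "j < ?N" for j
  proof (rule eq_vecI)
    fix i assume "i < dim_vec (col (map_mat f A) (pick ?J j))"
    then have i: "i < dim_row A" by simp
    have "submatrix A UNIV ?J $$ (i, j) = A $$ (i, pick ?J j)"
      using submatrix_index[of i A UNIV j ?J] i j by (simp add: pick_UNIV)
    then show "col ?A j $ i = col (map_mat f A) (pick ?J j) $ i"
      using i j pickJ[OF j] by (simp add: delete_cols_def dim_submatrix)
  qed (simp add: delete_cols_def dim_submatrix)
  have "pick ?J ` {..<?N} = ?J"
  proof (intro equalityI subsetI)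
    \<comment> \<open>The new position of \<open>i\<close> is the number of surviving indices below
      it.\<close>
    fix i assume i: "i \<in> ?J"
    have "{a \<in> ?J. a < i} \<subset> {j. j < dim_col A \<and> j \<in> ?J}" using i by auto
    then have "card {a \<in> ?J. a < i} < ?N" by (intro psubset_card_mono) auto
    then show "i \<in> pick ?J ` {..<?N}"
      by (intro image_eqI[of _ _ "card {a \<in> ?J. a < i}"])
        (simp_all only: pick_card_in_set[OF i] lessThan_iff)
  qed (use pickJ in auto)
  then have "col (map_mat f A) ` ?J = (\<lambda>j. col (map_mat f A) (pick ?J j)) ` {..<?N}"
    by (metis image_image)
  also have "\<dots> = col ?A ` {..<?N}" by (rule image_cong) (simp_all only: col lessThan_iff)
  also have "\<dots> = set (cols ?A)" unfolding cols_def N by (simp only: set_map set_upt atLeast0LessThan)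
  finally show ?thesis by (rule sym)
qed

text \<open>The blocks have distinct minima, so each position in the sorted list of minima selects
  exactly one block and the \<open>THE\<close> in \<open>block\<close> is well defined. For ranks
  only the resulting set of blocks matters.\<close>

lemma block_image:
  assumes "finite P" "inj_on Min P"
  shows "block P ` {..<card P} = P"
proof -
  let ?L = "sorted_list_of_set (Min ` P)"
  have fin: "finite (Min ` P)" using assms by simp
  have len: "length ?L = card P" using assms by (simp add: card_image)
  have set: "set ?L = Min ` P" using fin by simp
  have blk: "block P j = T" if "T \<in> P" "?L ! j = Min T" for T j
    unfolding block_def that(2) using assms(2) that(1) by (intro the_equality) (auto dest: inj_onD)
  show ?thesis
  proof (intro equalityI subsetI)
    fix T assume "T \<in> block P ` {..<card P}"
    then obtain j where j: "j < card P" "T = block P j" by auto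
    then have "?L ! j \<in> Min ` P" using set len by (metis nth_mem)
    then obtain T' where "T' \<in> P" "?L ! j = Min T'" by auto
    then show "T \<in> P" using blk j by auto
  next
    fix T assume T: "T \<in> P"
    then have "Min T \<in> set ?L" using set by auto
    then obtain j where "j < card P" "?L ! j = Min T" using len by (metis in_set_conv_nth)
    then show "T \<in> block P ` {..<card P}" using blk T by force
  qed
qed

text \<open>From here on the coordinate \<open>Min T\<close> represents the block \<open>T\<close>:
  it lies in \<open>T\<close>, and disjointness of the blocks keeps the representatives
  distinct.\<close>

lemma vec_partition_props:
  fixes x :: "int Matrix.vec"
  assumes "dim_vec x = m" and P: "P = vec_partition x"
  shows "finite P" "\<And>T. T \<in> P \<Longrightarrow> T \<subseteq> {..<m}" "\<And>T. T \<in> P \<Longrightarrow> Min T \<in> T" "\<Union>P = {..<m}"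
    "\<And>T. T \<in> P \<Longrightarrow> finite T"
    "\<And>T i j. T \<in> P \<Longrightarrow> i \<in> T \<Longrightarrow> j < m \<Longrightarrow> j \<in> T \<longleftrightarrow> x $ j = x $ i"
    "\<And>T T'. T \<in> P \<Longrightarrow> T' \<in> P \<Longrightarrow> T \<noteq> T' \<Longrightarrow> T \<inter> T' = {}" "inj_on Min P"
proof -
  show fin: "finite P" and sub: "\<And>T. T \<in> P \<Longrightarrow> T \<subseteq> {..<m}" and "\<Union>P = {..<m}"
    and eq: "\<And>T i j. T \<in> P \<Longrightarrow> i \<in> T \<Longrightarrow> j < m \<Longrightarrow> j \<in> T \<longleftrightarrow> x $ j = x $ i"
    using assms by (auto simp: vec_partition_def)
  show dis: "\<And>T T'. T \<in> P \<Longrightarrow> T' \<in> P \<Longrightarrow> T \<noteq> T' \<Longrightarrow> T \<inter> T' = {}"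
    using assms by (auto simp: vec_partition_def)
  show f: "\<And>T. T \<in> P \<Longrightarrow> finite T" using sub finite_subset by blast
  have "\<And>T. T \<in> P \<Longrightarrow> T \<noteq> {}" using assms by (auto simp: vec_partition_def)
  then show mi: "\<And>T. T \<in> P \<Longrightarrow> Min T \<in> T" using f by auto
  show "inj_on Min P" using dis mi by (intro inj_onI) (metis disjoint_iff)
qed

text \<open>A column of the contracted matrix, indexed by its block rather than by its position, and
  with entries in the field over which \<open>int_rank\<close> is taken.\<close>

definition block_sum :: "int mat \<Rightarrow> nat set \<Rightarrow> rat Matrix.vec" where
  "block_sum A T = Matrix.vec (dim_row A) (\<lambda>i. \<Sum>k\<in>T. rat_of_int (A $$ (i, k)))"

lemma set_cols_contract_mat:
  assumes "finite P" "inj_on Min P"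
  shows "set (cols (map_mat rat_of_int (contract_mat A P))) = block_sum A ` P"
proof -
  let ?C = "map_mat rat_of_int (contract_mat A P)"
  have "col ?C j = block_sum A (block P j)" if "j < card P" for j
    using that by (intro eq_vecI) (auto simp: contract_mat_def block_sum_def)
  then have "set (cols ?C) = (\<lambda>j. block_sum A (block P j)) ` {..<card P}"
    unfolding cols_def by (auto simp: contract_mat_def image_iff)
  then show ?thesis using block_image[OF assms] by (metis image_image)
qed

lemma mat_kernel_row_sum:
  fixes A :: "int mat"
  assumes "A \<in> carrier_mat r m" "x \<in> mat_kernel A" "i < r"
  shows "(\<Sum>k<m. A $$ (i, k) * x $ k) = 0"
proof -
  have x: "x \<in> carrier_vec m" "A *\<^sub>v x = 0\<^sub>v r" using mat_kernelD[OF assms(1,2)] by auto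
  have "(A *\<^sub>v x) $ i = (\<Sum>k<m. A $$ (i, k) * x $ k)"
    using assms x(1) by (auto simp: scalar_prod_def lessThan_atLeast0 intro!: sum.cong)
  then show ?thesis using x(2) assms(3) by simp
qed

text \<open>\<open>R\<close> collects blocks meeting \<open>Q\<close> whose values are forced by the
  other blocks in \<open>I\<close>. It is a minimal set of blocks whose sums, together with the
  columns outside \<open>Q\<close>, span all block sums. The difference of two solutions with
  pattern \<open>P\<close> is a linear relation among the block sums; if it vanishes on
  \<open>I - R\<close>, minimality makes it vanish on \<open>R\<close> as well.\<close>

lemma nontrivial_pattern_determined:
  fixes A :: "int mat"
  assumes A: "A \<in> carrier_mat r m" and x0: "x0 \<in> nontrivial_solutions A"
    and P: "P = vec_partition x0" and Q: "Q \<subseteq> {..<m}" and I: "I = {T \<in> P. T \<inter> Q \<noteq> {}}"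
  obtains R where "R \<subseteq> I" "rank_drop A Q \<le> int (card R)"
    "\<And>x y T. x \<in> mat_kernel A \<Longrightarrow> y \<in> mat_kernel A \<Longrightarrow> vec_partition x = P \<Longrightarrow> vec_partition y = P
      \<Longrightarrow> (\<And>T. T \<in> I - R \<Longrightarrow> x $ Min T = y $ Min T) \<Longrightarrow> T \<in> I \<Longrightarrow> x $ Min T = y $ Min T"
proof -
  interpret V: vec_space "TYPE(rat)" r .
  let ?A = "map_mat rat_of_int A" and ?D = "map_mat rat_of_int (delete_cols A Q)"
  let ?C = "map_mat rat_of_int (contract_mat A P)"
  let ?W = "col ?A ` ({..<m} - Q)"
  have dimA: "dim_row A = r" "dim_col A = m" using A by auto
  have x0k: "x0 \<in> mat_kernel A" and rkC: "int_rank (contract_mat A P) = int_rank A"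
    using x0 P by (auto simp: nontrivial_solutions_def)
  have dimx: "dim_vec x = m" if "x \<in> mat_kernel A" for x
    using mat_kernelD(1)[OF A that] by auto
  note PP = vec_partition_props[OF dimx[OF x0k] P]
  have cA: "?A \<in> carrier_mat r m" using A by auto
  have cD: "?D \<in> carrier_mat r (dim_col ?D)" using dimA by (auto simp: delete_cols_def dim_submatrix)
  have cC: "?C \<in> carrier_mat r (dim_col ?C)" using dimA by (auto simp: contract_mat_def)
  have colsA: "set (cols ?A) = col ?A ` {..<m}" using dimA by (auto simp: cols_def image_iff)
  have colsD: "set (cols ?D) = ?W" using set_cols_delete_cols[of rat_of_int A Q] dimA by simp
  have colsC: "set (cols ?C) = block_sum A ` P" using set_cols_contract_mat PP(1,8) by blast
  have rkC': "V.rank ?C = V.rank ?A" using rkC cC by (simp add: int_rank_def dimA contract_mat_def)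
  have rkD: "V.rank ?D = int_rank (delete_cols A Q)" using dimA
    by (simp add: int_rank_def delete_cols_def dim_submatrix)
  have carA: "col ?A ` S \<subseteq> carrier_vec r" for S using dimA by (auto intro!: carrier_vecI)
  have bs: "block_sum A T \<in> V.span (col ?A ` T)" if "T \<subseteq> {..<m}" for T
  proof -
    have "block_sum A T = Matrix.vec r (\<lambda>i. \<Sum>k\<in>T. 1 * col ?A k $ i)"
      using that dimA by (intro eq_vecI) (auto simp: block_sum_def intro!: sum.cong)
    also have "\<dots> \<in> V.span (col ?A ` T)"
    proof (rule V.weighted_sum_in_span[OF carA])
      show "col ?A k \<in> V.span (col ?A ` T)" if "k \<in> T" for k
        using V.in_own_span[OF carA[of T]] that by blast
    qed (use finite_subset[OF that] in simp)
    finally show ?thesis .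
  qed
  have bcar: "block_sum A T \<in> carrier_vec r" for T by (simp add: block_sum_def dimA)
  have "block_sum A T \<in> V.span (set (cols ?A))" if "T \<in> P" for T
    using bs[OF PP(2)[OF that]] V.span_is_monotone[OF image_mono[OF PP(2)[OF that]], of "col ?A"] colsA
    by (auto)
  then have "block_sum A ` P \<subseteq> V.span (set (cols ?A))" by blast
  \<comment> \<open>Here non-triviality of \<open>x0\<close> enters: contracting along
    \<open>P\<close> does not lower the rank, so the block sums recover every column of
    \<open>A\<close>.\<close>
  then have AC: "set (cols ?A) \<subseteq> V.span (block_sum A ` P)"
    using V.cols_subset_span_if_rank_eq[OF cA cC _ rkC'] colsC by simp
  \<comment> \<open>A block that misses \<open>Q\<close> is a sum of surviving columns, so it
    contributes nothing modulo \<open>?W\<close>.\<close>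
  have O: "block_sum A T \<in> V.span ?W" if T: "T \<in> P - I" for T
  proof -
    have "T \<subseteq> {..<m} - Q" using T I PP(2)[of T] by auto
    then show ?thesis using bs[of T] V.span_is_monotone[of "col ?A ` T" ?W] PP(2)[of T] T by blast
  qed
  have IP: "I \<subseteq> P" using I by auto
  obtain R where R: "R \<subseteq> I" "block_sum A ` P \<subseteq> V.span (?W \<union> block_sum A ` R)"
    and det: "\<And>z T. (\<And>i. i < r \<Longrightarrow> (\<Sum>T\<in>P. z T * block_sum A T $ i) = 0)
        \<Longrightarrow> (\<And>T. T \<in> I - R \<Longrightarrow> z T = 0) \<Longrightarrow> T \<in> R \<Longrightarrow> z T = 0"
    using V.minimal_generating_family[of ?W P "block_sum A" I, OF carA PP(1) bcar O IP] by blast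
  have finR: "finite R" using R(1) IP PP(1) finite_subset by metis
  \<comment> \<open>Replacing the surviving columns by a basis of their span gives a generating set
    of at most \<open>V.rank ?D + card R\<close> vectors, whence the lower bound on
    \<open>card R\<close>.\<close>
  obtain B where B: "B \<subseteq> set (cols ?D)" "finite B" "card B = V.rank ?D" "set (cols ?D) \<subseteq> V.span B"
    using V.spanning_subset_of_cols[OF cD] by metis
  have cB: "B \<subseteq> carrier_vec r" using B(1) carA[of "{..<m} - Q"] unfolding colsD by (rule order_trans)
  let ?G = "B \<union> block_sum A ` R"
  have cG: "?G \<subseteq> carrier_vec r" using cB bcar by auto
  have "?W \<union> block_sum A ` R \<subseteq> V.span ?G"
    using B(4) V.span_is_monotone[of B ?G] V.in_own_span[OF cG] unfolding colsD by blast
  then have "V.span (?W \<union> block_sum A ` R) \<subseteq> V.span ?G" by (rule V.span_subsetI[OF cG])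
  then have "V.span (block_sum A ` P) \<subseteq> V.span ?G"
    using R(2) by (intro V.span_subsetI[OF cG]) auto
  then have "V.rank ?A \<le> card ?G"
    using AC B(2) finR cG by (intro V.rank_le_card_generating[OF cA]) auto
  also have "\<dots> \<le> card B + card R"
    using card_Un_le[of B "block_sum A ` R"] card_image_le[OF finR, of "block_sum A"] by linarith
  finally have rd: "rank_drop A Q \<le> int (card R)"
    using B(3) rkD by (simp add: rank_drop_def int_rank_def dimA)
  have res: "x $ Min T = y $ Min T"
    if x: "x \<in> mat_kernel A" "vec_partition x = P" and y: "y \<in> mat_kernel A" "vec_partition y = P"
      and agree: "\<And>T. T \<in> I - R \<Longrightarrow> x $ Min T = y $ Min T" and T: "T \<in> I" for x y T
  proof (cases "T \<in> R")
    case True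
    let ?z = "\<lambda>T. rat_of_int (x $ Min T - y $ Min T)"
    have const: "u $ k = u $ Min T" if "u \<in> mat_kernel A" "vec_partition u = P" "T \<in> P" "k \<in> T" for u T k
    proof -
      note U = vec_partition_props[OF dimx[OF that(1)] that(2)[symmetric]]
      show ?thesis using U(6)[of T "Min T" k] U(3)[of T] U(2)[of T] that(3,4) by auto
    qed
    \<comment> \<open>Both solutions are constant on each block, so the sum over blocks regroups the
      difference of the two row equations.\<close>
    have eq: "(\<Sum>T\<in>P. ?z T * block_sum A T $ i) = 0" if i: "i < r" for i
    proof -
      have "?z T * block_sum A T $ i
          = (\<Sum>k\<in>T. rat_of_int (A $$ (i, k) * x $ k - A $$ (i, k) * y $ k))" if T: "T \<in> P" for T
      proof -
        have "?z T * block_sum A T $ i = (\<Sum>k\<in>T. ?z T * rat_of_int (A $$ (i, k)))"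
          using i dimA by (simp add: block_sum_def sum_distrib_left)
        also have "\<dots> = (\<Sum>k\<in>T. rat_of_int (A $$ (i, k) * x $ k - A $$ (i, k) * y $ k))"
        proof (intro sum.cong refl)
          fix k assume "k \<in> T"
          then have "x $ k = x $ Min T" "y $ k = y $ Min T" using const x y T by blast+
          then show "?z T * rat_of_int (A $$ (i, k))
              = rat_of_int (A $$ (i, k) * x $ k - A $$ (i, k) * y $ k)"
            by (simp add: algebra_simps)
        qed
        finally show ?thesis .
      qed
      then have "(\<Sum>T\<in>P. ?z T * block_sum A T $ i)
          = (\<Sum>T\<in>P. \<Sum>k\<in>T. rat_of_int (A $$ (i, k) * x $ k - A $$ (i, k) * y $ k))"
        by (intro sum.cong refl)
      also have "\<dots> = (\<Sum>k\<in>\<Union>P. rat_of_int (A $$ (i, k) * x $ k - A $$ (i, k) * y $ k))"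
        using PP by (subst sum.Union_disjoint) (auto simp: o_def)
      also have "\<dots> = of_int ((\<Sum>k<m. A $$ (i, k) * x $ k) - (\<Sum>k<m. A $$ (i, k) * y $ k))"
        unfolding PP(4) by (simp only: sum_subtractf of_int_sum of_int_diff)
      finally show ?thesis using mat_kernel_row_sum[OF A] x y i by simp
    qed
    have "?z T = 0" by (rule det[OF eq]) (use agree True in auto)
    then show ?thesis by simp
  qed (use agree T in auto)
  show thesis by (rule that[OF R(1) rd]) (rule res)
qed

section \<open>Counting projected solutions\<close>

lemma sum_UNION_le:
  fixes f :: "'b \<Rightarrow> real"
  assumes "finite I" "\<And>i. i \<in> I \<Longrightarrow> finite (S i)" "\<And>x. 0 \<le> f x"
  shows "sum f (\<Union>i\<in>I. S i) \<le> (\<Sum>i\<in>I. sum f (S i))"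
  using assms(1,2)
proof (induction I)
  case (insert i I)
  have "sum f (S i \<union> (\<Union>i\<in>I. S i)) \<le> sum f (S i) + sum f (\<Union>i\<in>I. S i)"
    using insert sum.union_inter[of "S i" "\<Union>i\<in>I. S i" f] sum_nonneg[of "S i \<inter> (\<Union>i\<in>I. S i)" f] assms(3)
    by auto
  then show ?case using insert by fastforce
qed simp

text \<open>A hit is the set of values on \<open>Q\<close>, so solutions with the same such set
  count once; only whether the random set contains all these values matters.\<close>

definition pattern_hits :: "int mat \<Rightarrow> nat set \<Rightarrow> nat set set \<Rightarrow> nat \<Rightarrow> int set set" where
  "pattern_hits A Q P n = (\<lambda>x. ($) x ` Q) `
     {x \<in> nontrivial_solutions A. vec_partition x = P \<and> (\<forall>i<dim_col A. x $ i \<in> {1..int n})}"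

text \<open>Distinct blocks carry distinct values, so every hit has exactly as many elements as
  there are blocks meeting \<open>Q\<close>; this number is \<open>q'\<close>. The values on
  \<open>I - R\<close> determine the hit, which leaves at most n^(q' - |R|) choices. The last clause
  is a product, which avoids truncated subtraction in the exponent.\<close>

lemma pattern_hits_bound:
  fixes A :: "int mat"
  assumes A: "A \<in> carrier_mat r m" and x0: "x0 \<in> nontrivial_solutions A"
    and P: "P = vec_partition x0" and Q: "Q \<subseteq> {..<m}" "Q \<noteq> {}" and n: "n \<ge> 1"
  obtains q' where "1 \<le> q'" "q' \<le> card Q" "\<And>H. H \<in> pattern_hits A Q P n \<Longrightarrow> card H = q'"
    "card (pattern_hits A Q P n) * n ^ nat (rank_drop A Q) \<le> n ^ q'"
proof -
  define I where "I = {T \<in> P. T \<inter> Q \<noteq> {}}"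
  obtain R where R: "R \<subseteq> I" "rank_drop A Q \<le> int (card R)"
    and det: "\<And>x y T. x \<in> mat_kernel A \<Longrightarrow> y \<in> mat_kernel A \<Longrightarrow> vec_partition x = P \<Longrightarrow> vec_partition y = P
      \<Longrightarrow> (\<And>T. T \<in> I - R \<Longrightarrow> x $ Min T = y $ Min T) \<Longrightarrow> T \<in> I \<Longrightarrow> x $ Min T = y $ Min T"
    using nontrivial_pattern_determined[OF A x0 P Q(1) I_def] by metis
  have dimx: "dim_vec x = m" if "x \<in> nontrivial_solutions A" for x
    using mat_kernelD(1)[OF A, of x] that by (auto simp: nontrivial_solutions_def)
  note PP = vec_partition_props[OF dimx[OF x0] P]
  have finI: "finite I" using PP(1) by (simp add: I_def)
  have finR: "finite R" using R(1) finI finite_subset by blast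
  have finQ: "finite Q" using Q finite_subset by blast
  \<comment> \<open>Choosing a coordinate of \<open>Q\<close> in each block is injective by
    disjointness, which gives \<open>card I \<le> card Q\<close>.\<close>
  define f where "f T = (SOME i. i \<in> T \<inter> Q)" for T
  have f: "f T \<in> T \<inter> Q" if "T \<in> I" for T
    using that unfolding f_def I_def by (simp only: some_in_eq) blast
  have "inj_on f I"
  proof (rule inj_onI)
    fix T T' assume T: "T \<in> I" "T' \<in> I" "f T = f T'"
    then have "f T \<in> T \<inter> T'" using f[OF T(1)] f[OF T(2)] by auto
    then show "T = T'" using PP(7)[of T T'] T by (auto simp: I_def)
  qed
  moreover have "f ` I \<subseteq> Q" using f by auto
  ultimately have Ile: "card I \<le> card Q" using card_inj_on_le[OF _ _ finQ] by blast
  have cover: "\<exists>T\<in>P. k \<in> T" if "k \<in> Q" for k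
  proof -
    have "k \<in> \<Union>P" unfolding PP(4) using Q(1) that by (rule subsetD)
    then show ?thesis by (rule UnionE) (rule bexI)
  qed
  obtain k where "k \<in> Q" using Q(2) by (meson ex_in_conv)
  moreover obtain T where "T \<in> P" "k \<in> T" using cover[OF \<open>k \<in> Q\<close>] by (rule bexE)
  ultimately have "T \<in> I" unfolding I_def by auto
  then have "I \<noteq> {}" by auto
  then have I1: "1 \<le> card I" using finI by (simp add: Suc_le_eq card_gt_0_iff)
  let ?X = "{x \<in> nontrivial_solutions A. vec_partition x = P \<and> (\<forall>i<m. x $ i \<in> {1..int n})}"
  have img: "($) x ` Q = (\<lambda>T. x $ Min T) ` I" and inj: "inj_on (\<lambda>T. x $ Min T) I" if x: "x \<in> ?X" for x
  proof -
    note U = vec_partition_props[of x m P]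
    have U6: "j \<in> T \<longleftrightarrow> x $ j = x $ i" if "T \<in> P" "i \<in> T" "j < m" for T i j
      using U(6)[of T i j] that x dimx by auto
    have eq: "x $ k = x $ Min T" if "T \<in> P" "k \<in> T" for T k
      using U6[of T "Min T" k] PP(2,3)[of T] that by auto
    show "($) x ` Q = (\<lambda>T. x $ Min T) ` I"
    proof (intro equalityI subsetI)
      fix z assume "z \<in> ($) x ` Q"
      then obtain k where k: "k \<in> Q" "z = x $ k" by auto
      then obtain T where "T \<in> P" "k \<in> T" using cover[OF k(1)] by (elim bexE)
      moreover from this have "T \<in> I" using k(1) by (auto simp: I_def)
      ultimately show "z \<in> (\<lambda>T. x $ Min T) ` I" using eq[of T k] k(2) by (intro image_eqI[of _ _ T]) simp_all
    next
      fix z assume "z \<in> (\<lambda>T. x $ Min T) ` I"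
      then obtain T where T: "T \<in> I" "z = x $ Min T" by auto
      then have "T \<in> P" "f T \<in> T" "f T \<in> Q" using f[of T] by (auto simp: I_def)
      then show "z \<in> ($) x ` Q" using eq[of T "f T"] T(2) by (intro image_eqI[of _ _ "f T"]) auto
    qed
    show "inj_on (\<lambda>T. x $ Min T) I"
    proof (rule inj_onI)
      fix T T' assume T: "T \<in> I" "T' \<in> I" "x $ Min T = x $ Min T'"
      then have TP: "T \<in> P" "T' \<in> P" by (auto simp: I_def)
      then have "Min T \<in> T'" using U6[of T' "Min T'" "Min T"] PP(2)[of T] PP(3)[of T] PP(3)[of T'] T(3) by auto
      then show "T = T'" using PP(7)[OF TP] PP(3)[OF TP(1)] by blast
    qed
  qed
  \<comment> \<open>The free values of a solution. Restricting to \<open>I - R\<close> makes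
    \<open>g x\<close> an element of a finite product set, whose size is counted below.\<close>
  define g where "g x = restrict (\<lambda>T. x $ Min T) (I - R)" for x :: "int Matrix.vec"
  have hits: "pattern_hits A Q P n = (\<lambda>x. ($) x ` Q) ` ?X" using A by (simp add: pattern_hits_def)
  have gim: "g ` ?X \<subseteq> (I - R) \<rightarrow>\<^sub>E {1..int n}"
  proof clarify
    fix x assume x: "x \<in> nontrivial_solutions A" "P = vec_partition x" "\<forall>i<m. x $ i \<in> {1..int n}"
    have "Min T < m" if "T \<in> I - R" for T using PP(2,3)[of T] that by (auto simp: I_def)
    then show "g x \<in> (I - R) \<rightarrow>\<^sub>E {1..int n}" using x(3) unfolding g_def by (intro restrict_PiE_iff[THEN iffD2]) auto
  qed
  have fing: "finite (g ` ?X)"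
    by (rule finite_subset[OF gim finite_PiE]) (use finI in auto)
  have geq: "($) x ` Q = ($) y ` Q" if x: "x \<in> ?X" and y: "y \<in> ?X" and gxy: "g x = g y" for x y
  proof -
    have a: "x $ Min T = y $ Min T" if "T \<in> I - R" for T
      using fun_cong[OF gxy, of T] that by (simp add: g_def)
    have "x $ Min T = y $ Min T" if "T \<in> I" for T
      by (rule det[OF _ _ _ _ a that]) (use x y in \<open>auto simp: nontrivial_solutions_def\<close>)
    then show ?thesis unfolding img[OF x] img[OF y] by (rule image_cong[OF refl])
  qed
  have "pattern_hits A Q P n \<subseteq> (\<lambda>u. ($) (SOME x. x \<in> ?X \<and> g x = u) ` Q) ` g ` ?X"
  proof
    fix H assume "H \<in> pattern_hits A Q P n"
    then obtain x where x: "x \<in> ?X" "H = ($) x ` Q" unfolding hits by blast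
    let ?y = "SOME y. y \<in> ?X \<and> g y = g x"
    have "?y \<in> ?X \<and> g ?y = g x" by (rule someI[of _ x]) (use x in simp)
    then have "H = ($) ?y ` Q" using geq[OF x(1), of ?y] x(2) by simp
    then show "H \<in> (\<lambda>u. ($) (SOME x. x \<in> ?X \<and> g x = u) ` Q) ` g ` ?X" using x(1) by blast
  qed
  then have "card (pattern_hits A Q P n) \<le> card (g ` ?X)" by (rule surj_card_le[OF fing])
  also have "\<dots> \<le> card ((I - R) \<rightarrow>\<^sub>E {1..int n})" using gim finI by (intro card_mono finite_PiE) auto
  also have "\<dots> = n ^ card (I - R)" using finI by (simp add: card_PiE)
  finally have c1: "card (pattern_hits A Q P n) \<le> n ^ (card I - card R)"
    using R(1) finR by (simp add: card_Diff_subset)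
  have "n ^ nat (rank_drop A Q) \<le> n ^ card R" using R(2) n by (intro power_increasing) auto
  then have "card (pattern_hits A Q P n) * n ^ nat (rank_drop A Q) \<le> n ^ (card I - card R) * n ^ card R"
    using c1 by (intro mult_le_mono)
  also have "\<dots> = n ^ card I" using card_mono[OF finI R(1)] by (simp flip: power_add)
  finally have c2: "card (pattern_hits A Q P n) * n ^ nat (rank_drop A Q) \<le> n ^ card I" .
  have c3: "card H = card I" if "H \<in> pattern_hits A Q P n" for H
    using that img inj unfolding hits by (auto simp: card_image)
  show thesis by (rule that[OF I1 Ile c3 c2])
qed

text \<open>Sum the previous bound over all patterns; a pattern is a set of subsets of the m column
  indices, so there are at most 2^(2^m) of them. The family depends on n but not on p, and overlaps
  between patterns only make the sum smaller.\<close>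

lemma hitting_family:
  fixes A :: "int mat"
  assumes A: "A \<in> carrier_mat r m" and Q: "Q \<subseteq> {..<m}" "Q \<noteq> {}" and n: "n \<ge> 1"
  obtains F where "finite F" "\<And>H. H \<in> F \<Longrightarrow> H \<subseteq> {1..int n} \<and> H \<noteq> {} \<and> card H \<le> card Q"
    "\<And>x. x \<in> nontrivial_solutions A \<Longrightarrow> \<forall>i<m. x $ i \<in> {1..int n} \<Longrightarrow> ($) x ` Q \<in> F"
    "\<And>p. 0 \<le> p \<Longrightarrow> (\<Sum>H\<in>F. p ^ card H) * real n ^ nat (rank_drop A Q)
        \<le> 2 ^ 2 ^ m * max 1 (real n * p) ^ card Q"
proof -
  let ?X = "{x \<in> nontrivial_solutions A. \<forall>i<m. x $ i \<in> {1..int n}}"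
  let ?PP = "vec_partition ` ?X" and ?\<rho> = "nat (rank_drop A Q)"
  define F where "F = (\<lambda>x. ($) x ` Q) ` ?X"
  have dimx: "dim_vec x = m" if "x \<in> nontrivial_solutions A" for x
    using mat_kernelD(1)[OF A, of x] that by (auto simp: nontrivial_solutions_def)
  have sub: "?PP \<subseteq> Pow (Pow {..<m})"
  proof (rule image_subsetI)
    fix x assume "x \<in> ?X"
    then have x: "x \<in> nontrivial_solutions A" by blast
    show "vec_partition x \<in> Pow (Pow {..<m})"
      using vec_partition_props(2)[OF dimx[OF x] refl] by blast
  qed
  then have finP: "finite ?PP" by (rule finite_subset) simp
  have "card ?PP \<le> card (Pow (Pow {..<m}))" by (rule card_mono[OF _ sub]) simp
  then have cP: "card ?PP \<le> 2 ^ 2 ^ m" by (simp add: card_Pow)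
  have finQ: "finite Q" using Q finite_subset by blast
  have F: "F = (\<Union>P\<in>?PP. pattern_hits A Q P n)"
    using A by (auto simp: F_def pattern_hits_def)
  have FU: "H \<subseteq> {1..int n} \<and> H \<noteq> {} \<and> card H \<le> card Q" if "H \<in> F" for H
    using that Q by (auto simp: F_def card_image_le[OF finQ])
  have "F \<subseteq> Pow {1..int n}" using FU by blast
  then have finF: "finite F" by (rule finite_subset) simp
  have "(\<Sum>H\<in>F. p ^ card H) * real n ^ ?\<rho> \<le> 2 ^ 2 ^ m * max 1 (real n * p) ^ card Q" if p: "0 \<le> p" for p
  proof -
    let ?M = "max 1 (real n * p) ^ card Q"
    have one: "(\<Sum>H\<in>pattern_hits A Q P n. p ^ card H) * real n ^ ?\<rho> \<le> ?M" if P: "P \<in> ?PP" for P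
    proof -
      obtain x0 where x0: "x0 \<in> nontrivial_solutions A" "P = vec_partition x0" using P by blast
      obtain q' where q': "1 \<le> q'" "q' \<le> card Q" "\<And>H. H \<in> pattern_hits A Q P n \<Longrightarrow> card H = q'"
        "card (pattern_hits A Q P n) * n ^ ?\<rho> \<le> n ^ q'"
        using pattern_hits_bound[OF A x0 Q n] by metis
      have "(\<Sum>H\<in>pattern_hits A Q P n. p ^ card H) = real (card (pattern_hits A Q P n)) * p ^ q'"
        using q'(3) by simp
      then have "(\<Sum>H\<in>pattern_hits A Q P n. p ^ card H) * real n ^ ?\<rho>
          = real (card (pattern_hits A Q P n) * n ^ ?\<rho>) * p ^ q'" by simp
      also have "\<dots> \<le> real (n ^ q') * p ^ q'"
        using q'(4) p by (intro mult_right_mono of_nat_mono) auto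
      also have "\<dots> = (real n * p) ^ q'" by (simp add: power_mult_distrib)
      \<comment> \<open>With base at least 1 the power grows with the exponent, so patterns with
        different \<open>q'\<close> share one bound.\<close>
      also have "\<dots> \<le> max 1 (real n * p) ^ q'" using p by (intro power_mono) auto
      also have "\<dots> \<le> ?M" using q'(2) by (intro power_increasing) auto
      finally show ?thesis .
    qed
    have finh: "finite (pattern_hits A Q P n)" if "P \<in> ?PP" for P
    proof (rule finite_subset[OF _ finF])
      show "pattern_hits A Q P n \<subseteq> F" unfolding F using that by blast
    qed
    have "(\<Sum>H\<in>F. p ^ card H) \<le> (\<Sum>P\<in>?PP. \<Sum>H\<in>pattern_hits A Q P n. p ^ card H)"
      unfolding F using finP finh p by (intro sum_UNION_le) auto
    then have "(\<Sum>H\<in>F. p ^ card H) * real n ^ ?\<rho>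
        \<le> (\<Sum>P\<in>?PP. \<Sum>H\<in>pattern_hits A Q P n. p ^ card H) * real n ^ ?\<rho>"
      by (intro mult_right_mono) auto
    also have "\<dots> = (\<Sum>P\<in>?PP. (\<Sum>H\<in>pattern_hits A Q P n. p ^ card H) * real n ^ ?\<rho>)"
      by (rule sum_distrib_right)
    also have "\<dots> \<le> (\<Sum>P\<in>?PP. ?M)" by (rule sum_mono) (rule one)
    also have "\<dots> = real (card ?PP) * ?M" by simp
    also have "\<dots> \<le> 2 ^ 2 ^ m * ?M"
    proof (rule mult_right_mono)
      show "real (card ?PP) \<le> 2 ^ 2 ^ m" using of_nat_mono[OF cP, where 'a = real] by simp
    qed simp
    finally show ?thesis .
  qed
  moreover have "($) x ` Q \<in> F" if "x \<in> nontrivial_solutions A" "\<forall>i<m. x $ i \<in> {1..int n}" for x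
    using that by (auto simp: F_def)
  ultimately show thesis using that[of F] finF FU by blast
qed

section \<open>Binomial random subsets\<close>

lemma set_random_subset:
  "p \<in> {0..1} \<Longrightarrow> T \<in> set_pmf (random_subset n p) \<Longrightarrow> T \<subseteq> {1..int n}"
  by (auto simp: random_subset_def)

lemma prob_superset_random_subset:
  assumes p: "p \<in> {0..1}" and H: "H \<subseteq> {1..int n}"
  shows "measure_pmf.prob (random_subset n p) {T. H \<subseteq> T} = p ^ card H"
proof -
  let ?U = "{1..int n}"
  let ?M = "Pi_pmf ?U False (\<lambda>_. bernoulli_pmf p)"
  let ?B = "\<lambda>k. if k \<in> H then {True} else (UNIV :: bool set)"
  have "measure_pmf.prob (random_subset n p) {T. H \<subseteq> T} = measure_pmf.prob ?M (Pi ?U ?B)"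
    unfolding random_subset_def measure_map_pmf
    by (rule arg_cong[of _ _ "measure_pmf.prob ?M"]) (use H in \<open>auto simp: Pi_def\<close>)
  also have "\<dots> = (\<Prod>k\<in>?U. measure_pmf.prob (bernoulli_pmf p) (?B k))"
    by (rule measure_Pi_pmf_Pi) simp
  also have "\<dots> = (\<Prod>k\<in>?U. if k \<in> H then p else 1)"
    using p by (intro prod.cong) (auto simp: measure_pmf_single)
  also have "\<dots> = (\<Prod>k\<in>H. p)"
    using H by (simp add: prod.If_cases Int_absorb1)
  finally show ?thesis by simp
qed

lemma prob_contains_some_le:
  assumes p: "p \<in> {0..1}" and F: "finite F" "\<And>H. H \<in> F \<Longrightarrow> H \<subseteq> {1..int n}"
  shows "measure_pmf.prob (random_subset n p) {T. \<exists>H\<in>F. H \<subseteq> T} \<le> (\<Sum>H\<in>F. p ^ card H)"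
proof -
  have "measure_pmf.prob (random_subset n p) (\<Union>H\<in>F. {T. H \<subseteq> T})
      \<le> (\<Sum>H\<in>F. measure_pmf.prob (random_subset n p) {T. H \<subseteq> T})"
    using F(1) by (intro measure_pmf.finite_measure_subadditive_finite) auto
  also have "\<dots> = (\<Sum>H\<in>F. p ^ card H)"
    using p F by (intro sum.cong prob_superset_random_subset) auto
  finally show ?thesis by (simp add: Collect_bex_eq)
qed

text \<open>The expected number of disjoint families contained in the random set, each family
  \<open>G\<close> being weighted by \<open>exp (card G)\<close>, is at most \<open>\<Prod>H\<in>F. 1 + exp 1 * p ^ card H\<close>.\<close>

lemma prob_disjoint_family_le:
  assumes p: "p \<in> {0..1}" and F: "finite F" "\<And>H. H \<in> F \<Longrightarrow> H \<subseteq> {1..int n}"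
  shows "measure_pmf.prob (random_subset n p)
      {T. \<exists>G\<subseteq>F. pairwise disjnt G \<and> k \<le> real (card G) \<and> \<Union>G \<subseteq> T}
    \<le> exp (exp 1 * (\<Sum>H\<in>F. p ^ card H) - k)"
proof -
  let ?M = "measure_pmf.prob (random_subset n p)"
  let ?G = "{G. G \<subseteq> F \<and> pairwise disjnt G \<and> k \<le> real (card G)}"
  have p0: "0 \<le> p" using p by simp
  have finG: "finite ?G" using F(1) by (auto intro: finite_subset[of _ "Pow F"])
  have fin: "finite H" if "H \<in> F" for H using F(2)[OF that] finite_subset by blast
  have "?M (\<Union>G\<in>?G. {T. \<Union>G \<subseteq> T}) \<le> (\<Sum>G\<in>?G. ?M {T. \<Union>G \<subseteq> T})"
    using finG by (intro measure_pmf.finite_measure_subadditive_finite) auto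
  also have "\<dots> \<le> (\<Sum>G\<in>?G. exp (- k) * (\<Prod>H\<in>G. exp 1 * p ^ card H))"
  proof (rule sum_mono)
    fix G assume "G \<in> ?G"
    then have G: "G \<subseteq> F" "pairwise disjnt G" "k \<le> real (card G)" by auto
    have fG: "finite G" using G(1) F(1) finite_subset by blast
    \<comment> \<open>Disjointness turns the probability of containing the union into a product over
      the members of \<open>G\<close>.\<close>
    have cU: "card (\<Union>G) = (\<Sum>H\<in>G. card H)"
      using G fin by (intro card_Union_disjoint) auto
    have "?M {T. \<Union>G \<subseteq> T} = p ^ card (\<Union>G)"
      using G(1) F(2) by (intro prob_superset_random_subset p) blast
    also have "\<dots> = (\<Prod>H\<in>G. p ^ card H)" unfolding cU by (rule power_sum)
    \<comment> \<open>The inserted factor is at least 1 because \<open>G\<close> has at least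
      \<open>k\<close> members; it moves a factor e into each term of the product.\<close>
    also have "\<dots> \<le> exp (real (card G) - k) * (\<Prod>H\<in>G. p ^ card H)"
      using mult_right_mono[of 1 "exp (real (card G) - k)" "\<Prod>H\<in>G. p ^ card H"] G(3) p0
      by (simp add: prod_nonneg)
    also have "\<dots> = exp (- k) * (\<Prod>H\<in>G. exp 1 * p ^ card H)"
      by (simp add: prod.distrib exp_diff exp_minus field_simps exp_of_nat_mult[symmetric])
    finally show "?M {T. \<Union>G \<subseteq> T} \<le> exp (- k) * (\<Prod>H\<in>G. exp 1 * p ^ card H)" .
  qed
  \<comment> \<open>Dropping disjointness and the size condition leaves the full expansion of a
    product of binomials.\<close>
  also have "\<dots> \<le> (\<Sum>G\<in>Pow F. exp (- k) * (\<Prod>H\<in>G. exp 1 * p ^ card H))"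
    using F(1) p0 by (intro sum_mono2 mult_nonneg_nonneg prod_nonneg) auto
  also have "\<dots> = exp (- k) * (\<Prod>H\<in>F. 1 + exp 1 * p ^ card H)"
    using prod_add[OF F(1), of "\<lambda>H. exp 1 * p ^ card H" "\<lambda>_. 1"]
    by (simp add: sum_distrib_left add.commute)
  also have "\<dots> \<le> exp (- k) * (\<Prod>H\<in>F. exp (exp 1 * p ^ card H))"
    using p0 by (intro mult_left_mono prod_mono) (auto intro: exp_ge_add_one_self add_nonneg_nonneg)
  also have "\<dots> = exp (exp 1 * (\<Sum>H\<in>F. p ^ card H) - k)"
    using F(1) by (simp add: exp_sum[symmetric] sum_distrib_left exp_diff exp_minus field_simps)
  finally show ?thesis by (simp add: Collect_ex_eq[symmetric] conj_ac UN_iff setcompr_eq_image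
      Bex_def[symmetric] Collect_bex_eq[symmetric] cong: conj_cong)
qed

section \<open>Lower tail of the size of the random subset\<close>

lemma expectation_exp_card_random_subset:
  assumes p: "p \<in> {0..1}"
  shows "measure_pmf.expectation (random_subset n p) (\<lambda>T. exp (- real (card T)))
    = (1 - p + p * exp (- 1)) ^ n"
proof -
  let ?U = "{1..int n}"
  let ?M = "Pi_pmf ?U False (\<lambda>_. bernoulli_pmf p)"
  have "exp (- real (card {k \<in> ?U. f k})) = (\<Prod>k\<in>?U. if f k then exp (- 1) else 1 :: real)" for f
    by (simp add: prod.If_cases Int_def exp_of_nat_mult[symmetric] flip: exp_of_nat_mult)
  then have "measure_pmf.expectation (random_subset n p) (\<lambda>T. exp (- real (card T)))
      = measure_pmf.expectation ?M (\<lambda>f. \<Prod>k\<in>?U. if f k then exp (- 1) else 1)"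
    unfolding random_subset_def by simp
  also have "\<dots> = (\<Prod>k\<in>?U. measure_pmf.expectation (bernoulli_pmf p) (\<lambda>b. if b then exp (- 1) else 1))"
    by (rule expectation_prod_Pi_pmf) (auto intro: integrable_measure_pmf_finite)
  also have "\<dots> = (1 - p + p * exp (- 1)) ^ n"
    using p by (simp add: add.commute mult.commute)
  finally show ?thesis .
qed

text \<open>Markov's inequality for exp(-|T|), followed by 1 + x \<le> exp x. This fixed exponential
  weight already gives the rate 1/2 - 1/e, which \<open>exp_minus_one_less_half\<close> shows to be
  positive.\<close>

lemma prob_random_subset_small_le:
  assumes p: "p \<in> {0..1}"
  shows "measure_pmf.prob (random_subset n p) {T. real (card T) \<le> real n * p / 2}
    \<le> exp (- (1 / 2 - exp (- 1)) * (real n * p))"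
proof -
  let ?R = "random_subset n p" and ?a = "exp (- (real n * p / 2))"
  have int: "integrable (measure_pmf ?R) (\<lambda>T. exp (- real (card T)))"
    by (rule measure_pmf.integrable_const_bound[where B = 1]) auto
  have "{T. real (card T) \<le> real n * p / 2} = {T \<in> space (measure_pmf ?R). ?a \<le> exp (- real (card T))}"
    by auto
  then have "measure_pmf.prob ?R {T. real (card T) \<le> real n * p / 2}
      \<le> measure_pmf.expectation ?R (\<lambda>T. exp (- real (card T))) / ?a"
    using integral_Markov_inequality_measure[OF int, of "{}" ?a] by simp
  also have "\<dots> = (1 - p + p * exp (- 1)) ^ n * exp (real n * p / 2)"
    unfolding expectation_exp_card_random_subset[OF p] divide_inverse exp_minus[symmetric] minus_minus ..
  also have "\<dots> \<le> exp (- p + p * exp (- 1)) ^ n * exp (real n * p / 2)"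
  proof (intro mult_right_mono power_mono)
    show "1 - p + p * exp (- 1) \<le> exp (- p + p * exp (- 1))"
      using exp_ge_add_one_self[of "- p + p * exp (- 1)"] by linarith
    show "0 \<le> 1 - p + p * exp (- 1)" using p by (intro add_nonneg_nonneg) auto
  qed simp
  also have "\<dots> = exp (- (1 / 2 - exp (- 1)) * (real n * p))"
    by (simp add: exp_of_nat_mult[symmetric] exp_add[symmetric] algebra_simps)
  finally show ?thesis .
qed

text \<open>Delete a maximal disjoint family of members of \<open>F\<close> from \<open>T\<close>; by maximality no member
  of \<open>F\<close> survives.\<close>

lemma dense_subset_or_disjoint_family:
  fixes \<epsilon> :: real and T :: "int set"
  assumes T: "finite T" and F: "finite F" "\<And>H. H \<in> F \<Longrightarrow> H \<noteq> {} \<and> card H \<le> m"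
  obtains (sparse) S where "S \<subseteq> T" "\<epsilon> * real (card T) \<le> real (card S)" "\<And>H. H \<in> F \<Longrightarrow> \<not> H \<subseteq> S"
  | (family) G where "G \<subseteq> F" "pairwise disjnt G" "\<Union>G \<subseteq> T" "(1 - \<epsilon>) * real (card T) \<le> real m * real (card G)"
proof -
  let ?P = "\<lambda>G. G \<subseteq> F \<and> pairwise disjnt G \<and> \<Union>G \<subseteq> T"
  have bound: "\<forall>G. ?P G \<longrightarrow> card G \<le> card F" using F(1) by (auto intro: card_mono)
  have "?P {}" by simp
  then obtain G where G: "?P G" and max: "\<forall>G'. ?P G' \<longrightarrow> card G' \<le> card G"
    using ex_has_greatest_nat[of ?P "{}" card "Suc (card F)"] bound by (auto simp: less_Suc_eq_le)
  have fG: "finite G" using G F(1) finite_subset by blast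
  let ?S = "T - \<Union>G"
  have hit: "\<not> H \<subseteq> ?S" if H: "H \<in> F" for H
  proof (rule notI)
    assume HS: "H \<subseteq> ?S"
    \<comment> \<open>A member of \<open>G\<close> inside \<open>?S\<close> would be disjoint from
      itself, hence empty.\<close>
    have "H \<notin> G" using HS F(2)[OF H] by auto
    then have "card (insert H G) = Suc (card G)" using fG by simp
    moreover have "?P (insert H G)"
      using G H HS by (auto simp: pairwise_insert disjnt_def)
    then have "card (insert H G) \<le> card G" by (rule max[rule_format])
    ultimately show False by linarith
  qed
  have "card (\<Union>G) \<le> sum card G" by (rule card_Union_le_sum_card)
  also have "\<dots> \<le> (\<Sum>H\<in>G. m)"
  proof (rule sum_mono)
    fix H assume "H \<in> G"
    then show "card H \<le> m" using F(2) G by blast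
  qed
  finally have cU: "card (\<Union>G) \<le> m * card G" by (simp add: mult.commute)
  have UT: "\<Union>G \<subseteq> T" using G by blast
  have "card ?S = card T - card (\<Union>G)"
    by (rule card_Diff_subset[OF finite_subset[OF UT T] UT])
  moreover have "card (\<Union>G) \<le> card T" by (rule card_mono[OF T UT])
  ultimately have cS: "real (card ?S) = real (card T) - real (card (\<Union>G))" by simp
  have cU': "real (card (\<Union>G)) \<le> real m * real (card G)"
    using cU by (metis of_nat_le_iff of_nat_mult)
  show thesis
  proof (cases "\<epsilon> * real (card T) \<le> real (card ?S)")
    case True
    then show ?thesis using sparse[of ?S] hit by auto
  next
    case False
    then have "(1 - \<epsilon>) * real (card T) \<le> real m * real (card G)"
      using cS cU' by (simp add: algebra_simps)
    then show ?thesis using family[of G] G by auto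
  qed
qed

section \<open>The threshold\<close>

text \<open>Any maximiser \<open>Q\<close> will do; taking all columns shows that the maximum exceeds 1, the
  value attained when \<open>rank_drop A Q = 0\<close>.\<close>

lemma max_1_density_attained:
  fixes A :: "int mat"
  assumes A: "A \<in> carrier_mat r m" and m: "m \<ge> 3" and nz: "A \<noteq> 0\<^sub>m r m" and ab: "abundant A"
  obtains Q where "Q \<subseteq> {..<m}" "card Q \<ge> 2" "rank_drop A Q \<ge> 1"
    "1 - 1 / max_1_density A = real_of_int (rank_drop A Q) / (real (card Q) - 1)"
proof -
  let ?A = "map_mat rat_of_int A"
  let ?S = "{Q. Q \<subseteq> {..<m} \<and> card Q \<ge> 2}"
  let ?v = "\<lambda>Q. (real (card Q) - 1) / (real (card Q) - real_of_int (rank_drop A Q) - 1)"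
  interpret V: vec_space "TYPE(rat)" r .
  have dimA: "dim_row A = r" "dim_col A = m" using A by auto
  have cA: "?A \<in> carrier_mat r m" using A by auto
  have rkA: "int_rank A = V.rank ?A" by (simp add: int_rank_def dimA)
  have rk1: "int_rank A \<ge> 1"
  proof (rule ccontr)
    assume "\<not> int_rank A \<ge> 1"
    then have z: "V.rank ?A = 0" using rkA by simp
    obtain B where B: "finite B" "card B = 0" "set (cols ?A) \<subseteq> V.span B"
      using V.spanning_subset_of_cols[OF cA] z by metis
    then have "set (cols ?A) \<subseteq> {0\<^sub>v r}" using V.span_empty by simp
    moreover have "col ?A j \<in> set (cols ?A)" if "j < m" for j
      unfolding cols_def set_map by (rule imageI) (use that dimA in simp)
    ultimately have col0: "col ?A j = 0\<^sub>v r" if "j < m" for j using that by blast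
    have "A = 0\<^sub>m r m"
    proof (rule eq_matI)
      fix i j assume ij: "i < dim_row (0\<^sub>m r m :: int mat)" "j < dim_col (0\<^sub>m r m :: int mat)"
      then have "col ?A j $ i = 0" using col0[of j] by simp
      then show "A $$ (i, j) = 0\<^sub>m r m $$ (i, j)" using ij dimA by simp
    qed (use dimA in auto)
    then show False using nz by simp
  qed
  have del_le: "int_rank (delete_cols A Q) \<le> card ({..<m} - Q)" for Q
  proof -
    let ?D = "map_mat rat_of_int (delete_cols A Q)"
    have "?D \<in> carrier_mat r (card ({..<m} - Q))"
      unfolding carrier_mat_def
      by (auto simp: delete_cols_def dim_submatrix dimA intro!: arg_cong[of _ _ card])
    then have "V.rank ?D \<le> card ({..<m} - Q)" by (rule V.rank_le_nc)
    moreover have "int_rank (delete_cols A Q) = V.rank ?D"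
      by (simp add: int_rank_def delete_cols_def dim_submatrix dimA)
    ultimately show ?thesis by simp
  qed
  \<comment> \<open>Abundance, used for one pair of columns, bounds the rank by m - 2; hence the
    denominator of \<open>?v {..<m}\<close> is at least 1.\<close>
  have "int_rank A = int_rank (delete_cols A {0, 1})"
    using ab m dimA unfolding abundant_def
    by (metis One_nat_def less_le_trans numeral_3_eq_3 zero_less_Suc Suc_less_eq zero_neq_one)
  also have "\<dots> \<le> m - 2" using del_le[of "{0, 1}"] m by (simp add: card_Diff_subset)
  finally have rk2: "int_rank A \<le> m - 2" .
  have "rank_drop A {..<m} = int (int_rank A)"
    using del_le[of "{..<m}"] by (simp add: rank_drop_def)
  then have v1: "1 < ?v {..<m}" using rk1 rk2 m by (simp add: field_simps)
  have fin: "finite ?S" by (rule finite_subset[of _ "Pow {..<m}"]) auto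
  have mS: "{..<m} \<in> ?S" using m by simp
  have mx: "max_1_density A = Max (?v ` ?S)" by (simp add: max_1_density_def dimA)
  have "Max (?v ` ?S) \<in> ?v ` ?S" using fin mS by (intro Max_in) blast+
  then obtain Q where Q: "Q \<in> ?S" "max_1_density A = ?v Q" unfolding mx by blast
  have "?v {..<m} \<le> max_1_density A" unfolding mx by (intro Max_ge finite_imageI imageI fin mS)
  \<comment> \<open>This also excludes a vanishing denominator at \<open>Q\<close>, where division
    by zero would give the value 0.\<close>
  then have v2: "1 < ?v Q" using v1 Q(2) by linarith
  have c2: "real (card Q) \<ge> 2" using Q(1) by simp
  have rd: "rank_drop A Q \<ge> 1"
  proof (rule ccontr)
    assume "\<not> rank_drop A Q \<ge> 1"
    then have "real_of_int (rank_drop A Q) \<le> 0" by simp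
    then have "?v Q \<le> 1" using c2 by (simp add: divide_simps)
    then show False using v2 by simp
  qed
  have "1 - 1 / max_1_density A = real_of_int (rank_drop A Q) / (real (card Q) - 1)"
    unfolding Q(2) using c2 by (simp add: field_simps)
  then show thesis using that[of Q] Q(1) rd by auto
qed

text \<open>For the first bound, solvability is applied to T itself. For the second, it is applied
  to what remains of T after deleting a maximal disjoint family: T then has at most n p / 2 elements
  or contains at least \<open>?k\<close> disjoint members of \<open>F\<close>, and the two tail
  bounds add up.\<close>

lemma prob_dense_solvable_le:
  fixes A :: "int mat" and \<epsilon> :: real
  assumes A: "A \<in> carrier_mat r m" and m: "m \<ge> 1" and \<epsilon>: "\<epsilon> < 1" and p: "p \<in> {0..1}"
    and Q: "Q \<subseteq> {..<m}"
    and F: "finite F" "\<And>H. H \<in> F \<Longrightarrow> H \<subseteq> {1..int n} \<and> H \<noteq> {} \<and> card H \<le> card Q"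
    and hit: "\<And>x. x \<in> nontrivial_solutions A \<Longrightarrow> \<forall>i<m. x $ i \<in> {1..int n} \<Longrightarrow> ($) x ` Q \<in> F"
  defines "P \<equiv> measure_pmf.prob (random_subset n p) {T. dense_solvable \<epsilon> T A}"
    and "\<mu> \<equiv> (\<Sum>H\<in>F. p ^ card H)"
  shows "P \<le> \<mu>"
    and "P \<le> exp (- (1 / 2 - exp (- 1)) * (real n * p))
           + exp (exp 1 * \<mu> - (1 - \<epsilon>) / (2 * real m) * (real n * p))"
proof -
  let ?R = "random_subset n p"
  let ?k = "(1 - \<epsilon>) / (2 * real m) * (real n * p)"
  have dimA: "dim_col A = m" using A by auto
  have Fm: "H \<noteq> {} \<and> card H \<le> m" if "H \<in> F" for H
    using F(2)[OF that] card_mono[OF _ Q] by auto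
  have Fn: "H \<subseteq> {1..int n}" if "H \<in> F" for H using F(2)[OF that] by blast
  have solvable: "\<exists>H\<in>F. H \<subseteq> S"
    if ds: "dense_solvable \<epsilon> T A" and T: "T \<subseteq> {1..int n}"
      and S: "S \<subseteq> T" "\<epsilon> * real (card T) \<le> real (card S)" for S T
  proof -
    obtain x where x: "x \<in> nontrivial_solutions A" "\<forall>i<m. x $ i \<in> S"
      using ds S unfolding dense_solvable_def dimA by blast
    have "\<forall>i<m. x $ i \<in> {1..int n}" using x(2) S(1) T by blast
    then have "($) x ` Q \<in> F" by (rule hit[OF x(1)])
    moreover have "($) x ` Q \<subseteq> S" using x(2) Q by blast
    ultimately show ?thesis by blast
  qed
  \<comment> \<open>Events need comparing only on subsets of [n], where the distribution is
    supported; \<open>hit\<close> speaks of no other solutions.\<close>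
  have mono: "measure_pmf.prob ?R X \<le> measure_pmf.prob ?R Y"
    if "\<And>T. T \<in> X \<Longrightarrow> T \<subseteq> {1..int n} \<Longrightarrow> T \<in> Y" for X Y
  proof -
    have "measure_pmf.prob ?R X = measure_pmf.prob ?R (X \<inter> set_pmf ?R)"
      by (rule measure_Int_set_pmf[symmetric])
    also have "\<dots> \<le> measure_pmf.prob ?R Y"
      using that set_random_subset[OF p] by (intro measure_pmf.finite_measure_mono) auto
    finally show ?thesis .
  qed
  have "P \<le> measure_pmf.prob ?R {T. \<exists>H\<in>F. H \<subseteq> T}"
    unfolding P_def
  proof (rule mono)
    fix T assume T: "T \<in> {T. dense_solvable \<epsilon> T A}" "T \<subseteq> {1..int n}"
    \<comment> \<open>As \<epsilon> < 1, the whole of \<open>T\<close> is itself an admissible dense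
      subset.\<close>
    have "\<epsilon> * real (card T) \<le> real (card T)" using \<epsilon> by (simp add: mult_left_le_one_le mult_le_cancel_right2)
    then show "T \<in> {T. \<exists>H\<in>F. H \<subseteq> T}" using solvable[of T T] T by simp
  qed
  also have "\<dots> \<le> \<mu>" unfolding \<mu>_def by (rule prob_contains_some_le[OF p F(1) Fn])
  finally show "P \<le> \<mu>" .
  let ?X = "{T :: int set. real (card T) \<le> real n * p / 2}"
  let ?Y = "{T. \<exists>G\<subseteq>F. pairwise disjnt G \<and> ?k \<le> real (card G) \<and> \<Union>G \<subseteq> T}"
  have "P \<le> measure_pmf.prob ?R (?X \<union> ?Y)"
    unfolding P_def
  proof (rule mono)
    fix T assume T: "T \<in> {T. dense_solvable \<epsilon> T A}" "T \<subseteq> {1..int n}"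
    have finT: "finite T" using T(2) finite_subset by blast
    show "T \<in> ?X \<union> ?Y"
    proof (rule dense_subset_or_disjoint_family[OF finT F(1), of m \<epsilon>])
      show "H \<noteq> {} \<and> card H \<le> m" if "H \<in> F" for H by (rule Fm[OF that])
    next
      fix S assume "S \<subseteq> T" "\<epsilon> * real (card T) \<le> real (card S)" "\<And>H. H \<in> F \<Longrightarrow> \<not> H \<subseteq> S"
      then show ?thesis using solvable[of T S] T by blast
    next
      fix G assume family: "G \<subseteq> F" "pairwise disjnt G" "\<Union>G \<subseteq> T"
        "(1 - \<epsilon>) * real (card T) \<le> real m * real (card G)"
      show ?thesis
      proof (cases "T \<in> ?X")
        case False
        then have "(1 - \<epsilon>) * (real n * p / 2) \<le> (1 - \<epsilon>) * real (card T)"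
          using \<epsilon> by (intro mult_left_mono) auto
        also have "\<dots> \<le> real m * real (card G)" by (rule family(4))
        finally have "?k \<le> real (card G)" using m by (simp add: field_simps)
        then show ?thesis using family(1-3) by blast
      qed simp
    qed
  qed
  also have "\<dots> \<le> measure_pmf.prob ?R ?X + measure_pmf.prob ?R ?Y"
    by (rule measure_Un_le) auto
  also have "\<dots> \<le> exp (- (1 / 2 - exp (- 1)) * (real n * p)) + exp (exp 1 * \<mu> - ?k)"
    unfolding \<mu>_def
    by (intro add_mono prob_random_subset_small_le[OF p] prob_disjoint_family_le[OF p F(1) Fn])
  finally show "P \<le> exp (- (1 / 2 - exp (- 1)) * (real n * p)) + exp (exp 1 * \<mu> - ?k)" .
qed

text \<open>This is where the exponent 1/m_1(A) enters: n p \<le> c n^(1 - a), and (1 - a)(q - 1) =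
  \<rho>, so q - 1 of the q factors n p are worth at most c^(q - 1) n^\<rho>. The remaining factor
  is kept, to be compared with the linear exponent of the tail bounds.\<close>

lemma max_density_scaling:
  fixes c p a :: real
  assumes n: "n \<ge> 1" and q: "q \<ge> 2" and c: "0 < c" "c \<le> 1" and p: "0 \<le> p"
    and le: "p \<le> c * real n powr (- a)" and a: "1 - a = real \<rho> / (real q - 1)" and big: "1 \<le> real n * p"
  shows "(real n * p) ^ q \<le> c * (real n * p) * real n ^ \<rho>"
proof -
  let ?y = "real n * p"
  have n0: "0 < real n" using n by simp
  have "?y \<le> real n * (c * real n powr (- a))" using le n0 by simp
  also have "\<dots> = c * real n powr (1 - a)" using n0 by (simp add: powr_diff powr_minus_divide)
  finally have y: "?y \<le> c * real n powr (1 - a)" .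
  have "?y ^ (q - 1) \<le> (c * real n powr (1 - a)) ^ (q - 1)" using y big by (intro power_mono) auto
  also have "\<dots> = c ^ (q - 1) * real n powr (real \<rho>)"
    using q n0 by (simp add: a power_mult_distrib powr_power)
  also have "\<dots> = c ^ (q - 1) * real n ^ \<rho>" using n0 by (simp add: powr_realpow)
  also have "\<dots> \<le> c ^ 1 * real n ^ \<rho>"
    using q c by (intro mult_right_mono power_decreasing) auto
  finally have "?y ^ (q - 1) * ?y \<le> (c * real n ^ \<rho>) * ?y" using big by (intro mult_right_mono) auto
  moreover have "?y ^ q = ?y ^ (q - 1) * ?y" using q by (metis power_minus_mult less_le_trans pos2)
  ultimately show ?thesis by (simp add: mult_ac)
qed

lemma exp_minus_one_less_half: "exp (- 1 :: real) < 1 / 2"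
proof -
  have "2 < exp (1 :: real)" using exp_lower_Taylor_quadratic[of 1] by simp
  then show ?thesis by (simp add: exp_minus field_simps)
qed

text \<open>When \<open>n p\<close> stays bounded the first moment of the hits already vanishes; when it is
  large the exponential bound applies, so \<open>n p\<close> need not converge.\<close>

lemma tendsto_zero_by_dichotomy:
  fixes P y :: "nat \<Rightarrow> real"
  assumes P: "\<And>n. 0 \<le> P n" and \<delta>: "0 < \<delta>"
    and large: "\<And>n. n \<ge> 1 \<Longrightarrow> 1 \<le> y n \<Longrightarrow> P n \<le> 2 * exp (- \<delta> * y n)"
    and small: "\<And>n. n \<ge> 1 \<Longrightarrow> P n * real n \<le> N * max 1 (y n) ^ q" and N: "0 \<le> N"
  shows "P \<longlonglongrightarrow> 0"
proof (rule LIMSEQ_I)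
  fix \<eta> :: real assume \<eta>: "0 < \<eta>"
  have "((\<lambda>x. 2 * exp (- \<delta> * x)) \<longlongrightarrow> 0) at_top" using \<delta> by real_asymp
  then have "\<forall>\<^sub>F x in at_top. 2 * exp (- \<delta> * x) < \<eta>" using \<eta> by (rule order_tendstoD(2))
  then obtain K0 where K0: "\<And>x. x \<ge> K0 \<Longrightarrow> 2 * exp (- \<delta> * x) < \<eta>"
    unfolding eventually_at_top_linorder by blast
  \<comment> \<open>At least 1, so that \<open>large\<close> applies above \<open>K\<close> and
    \<open>max 1 (y n) \<le> K\<close> below it.\<close>
  define K where "K = max 1 K0"
  obtain n0 :: nat where n0: "N * K ^ q / \<eta> < real n0" using reals_Archimedean2 by blast
  show "\<exists>no. \<forall>n\<ge>no. norm (P n - 0) < \<eta>"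
  proof (intro exI allI impI)
    fix n assume n: "n \<ge> max 1 n0"
    then have n1: "n \<ge> 1" by simp
    have "P n < \<eta>"
    proof (cases "y n \<ge> K")
      case True
      then show ?thesis using large[OF n1] K0[of "y n"] by (simp add: K_def)
    next
      case False
      have "P n * real n \<le> N * max 1 (y n) ^ q" by (rule small[OF n1])
      also have "\<dots> \<le> N * K ^ q" using False N by (intro mult_left_mono power_mono) (auto simp: K_def)
      also have "\<dots> < \<eta> * real n0" using n0 \<eta> by (simp add: field_simps)
      also have "\<dots> \<le> \<eta> * real n" using n \<eta> by (intro mult_left_mono) auto
      finally show ?thesis using n1 by simp
    qed
    then show "norm (P n - 0) < \<eta>" using P[of n] by simp
  qed
qed

text \<open>For \<epsilon> > 1 no nonempty set has a subset of the required density, and the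
  relation holds vacuously. For the zero matrix m_1(A) = 1 and every nonempty set satisfies the
  relation, so at p = c/n the probability tends to 1 - exp(-c) instead of 0.\<close>

theorem theorem1p4:
  fixes \<epsilon> :: real and r m :: nat and A :: "int mat"
  assumes "0 < \<epsilon>" and "\<epsilon> < 1"
    and "m \<ge> 3"
    and "A \<in> carrier_mat r m"
    and "A \<noteq> 0\<^sub>m r m"
    and "irredundant A" and "positive_mat A" and "abundant A"
  shows "\<exists>c>0. \<forall>p :: nat \<Rightarrow> real.
           (\<forall>n. 0 \<le> p n \<and> p n \<le> 1) \<longrightarrow>
           (\<forall>n\<ge>1. p n \<le> c * real n powr (- 1 / max_1_density A)) \<longrightarrow>
           (\<lambda>n. measure_pmf.prob (random_subset n (p n)) {T. dense_solvable \<epsilon> T A})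
             \<longlonglongrightarrow> 0"
proof -
  obtain Q where Q: "Q \<subseteq> {..<m}" "card Q \<ge> 2" "rank_drop A Q \<ge> 1"
    "1 - 1 / max_1_density A = real_of_int (rank_drop A Q) / (real (card Q) - 1)"
    using max_1_density_attained[OF assms(4,3,5,8)] by metis
  have Q0: "Q \<noteq> {}" using Q(2) by auto
  have m1: "m \<ge> 1" using assms(3) by simp
  define q where "q = card Q"
  define \<rho> where "\<rho> = nat (rank_drop A Q)"
  have \<rho>: "1 - 1 / max_1_density A = real \<rho> / (real q - 1)" "\<rho> \<ge> 1"
    using Q(3,4) by (auto simp: \<rho>_def q_def)
  define N :: real where "N = 2 ^ 2 ^ m"
  \<comment> \<open>More than \<kappa> n p would be the least size of the disjoint family only up to
    rounding; \<kappa> n p itself is the lower bound \<open>?k\<close> of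
    \<open>prob_dense_solvable_le\<close>.\<close>
  define \<kappa> where "\<kappa> = (1 - \<epsilon>) / (2 * real m)"
  \<comment> \<open>Chosen so that e times the first moment uses up at most half of \<kappa> n p,
    which is \<open>cN\<close>; the cap at 1 serves \<open>max_density_scaling\<close>.\<close>
  define c where "c = min 1 (\<kappa> / (2 * exp 1 * N))"
  define \<delta> where "\<delta> = min (1 / 2 - exp (- 1)) (\<kappa> / 2)"
  have N: "0 < N" by (simp add: N_def)
  have \<kappa>: "0 < \<kappa>" using assms(2,3) by (simp add: \<kappa>_def)
  have c: "0 < c" "c \<le> 1" using \<kappa> N by (auto simp: c_def)
  have cN: "exp 1 * (N * c) \<le> \<kappa> / 2"
  proof -
    have "c \<le> \<kappa> / (2 * exp 1 * N)" by (simp add: c_def)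
    then show ?thesis using N by (simp add: field_simps)
  qed
  have \<delta>: "0 < \<delta>" using \<kappa> exp_minus_one_less_half by (simp add: \<delta>_def)
  have "(\<lambda>n. measure_pmf.prob (random_subset n (p n)) {T. dense_solvable \<epsilon> T A}) \<longlonglongrightarrow> 0"
    if p: "\<And>n. 0 \<le> p n \<and> p n \<le> 1"
      and pc: "\<And>n. n \<ge> 1 \<Longrightarrow> p n \<le> c * real n powr (- 1 / max_1_density A)" for p :: "nat \<Rightarrow> real"
  proof (rule tendsto_zero_by_dichotomy[where y = "\<lambda>n. real n * p n", OF _ \<delta>])
    fix n :: nat assume n: "n \<ge> 1"
    let ?y = "real n * p n" and ?P = "measure_pmf.prob (random_subset n (p n)) {T. dense_solvable \<epsilon> T A}"
    obtain F where F: "finite F" "\<And>H. H \<in> F \<Longrightarrow> H \<subseteq> {1..int n} \<and> H \<noteq> {} \<and> card H \<le> card Q"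
      and hit: "\<And>x. x \<in> nontrivial_solutions A \<Longrightarrow> \<forall>i<m. x $ i \<in> {1..int n} \<Longrightarrow> ($) x ` Q \<in> F"
      and moment: "\<And>p. 0 \<le> p \<Longrightarrow> (\<Sum>H\<in>F. p ^ card H) * real n ^ \<rho>
        \<le> N * max 1 (real n * p) ^ q"
      using hitting_family[OF assms(4) Q(1) Q0 n] unfolding \<rho>_def q_def N_def by metis
    define \<mu> where "\<mu> = (\<Sum>H\<in>F. p n ^ card H)"
    have pI: "p n \<in> {0..1}" using p by simp
    have bound: "?P \<le> \<mu>"
      "?P \<le> exp (- (1 / 2 - exp (- 1)) * ?y) + exp (exp 1 * \<mu> - \<kappa> * ?y)"
      unfolding \<mu>_def \<kappa>_def
      by (rule prob_dense_solvable_le[OF assms(4) m1 assms(2) pI Q(1) F hit]; assumption)+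
    have \<mu>0: "0 \<le> \<mu>" using p by (auto simp: \<mu>_def intro!: sum_nonneg)
    have mom: "\<mu> * real n ^ \<rho> \<le> N * max 1 ?y ^ q" using moment[of "p n"] p by (simp add: \<mu>_def)
    \<comment> \<open>Since \<rho> \<ge> 1, the first moment bound gains at least one factor n,
      enough for the case of bounded n p.\<close>
    have "?P * real n \<le> \<mu> * real n ^ \<rho>"
      using bound(1) \<mu>0 n \<rho>(2) self_le_power[of "real n" \<rho>] by (intro mult_mono) auto
    then show "?P * real n \<le> N * max 1 ?y ^ q" using mom by linarith
    assume y1: "1 \<le> ?y"
    have "?y ^ q \<le> c * ?y * real n ^ \<rho>"
      by (rule max_density_scaling[where a = "1 / max_1_density A"])
        (use n Q(2) c p[of n] pc[OF n] \<rho>(1) y1 in \<open>auto simp: q_def\<close>)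
    then have "N * ?y ^ q \<le> N * (c * ?y * real n ^ \<rho>)" using N by (intro mult_left_mono) auto
    then have "\<mu> * real n ^ \<rho> \<le> (N * c * ?y) * real n ^ \<rho>"
      using mom y1 by (simp add: max_absorb2 mult_ac)
    then have "\<mu> \<le> N * c * ?y" using n by simp
    then have "exp 1 * \<mu> \<le> exp 1 * (N * c * ?y)" by simp
    also have "\<dots> \<le> \<kappa> / 2 * ?y"
      using mult_right_mono[OF cN, of ?y] y1 by (simp add: mult_ac)
    finally have "exp 1 * \<mu> - \<kappa> * ?y \<le> - (\<kappa> / 2) * ?y" by (simp add: field_simps)
    moreover have "\<delta> \<le> \<kappa> / 2" "\<delta> \<le> 1 / 2 - exp (- 1)"
      by (simp_all only: \<delta>_def min.cobounded1 min.cobounded2)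
    then have "- (\<kappa> / 2) * ?y \<le> - \<delta> * ?y" "- (1 / 2 - exp (- 1)) * ?y \<le> - \<delta> * ?y"
      using y1 by (intro mult_right_mono; linarith)+
    ultimately have "exp (- (1 / 2 - exp (- 1)) * ?y) + exp (exp 1 * \<mu> - \<kappa> * ?y)
        \<le> exp (- \<delta> * ?y) + exp (- \<delta> * ?y)"
      by (intro add_mono) (simp_all only: exp_le_cancel_iff)
    then show "?P \<le> 2 * exp (- \<delta> * ?y)" using bound(2) by linarith
  qed (use N in simp_all)
  then show ?thesis using c(1) by blast
qed

end
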